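(* Let $S$ be a zerosumfree semiring. Then $S$ is reversible if and only if the power series semiring $S[[X]]$ is reversible.
   Context: A semiring is an algebraic structure $(S,+,\cdot,0,1)$ such that $(S,+,0)$ is a commutative monoid, $(S,\cdot,1)$ is a (not necessarily commutative) monoid with $1\neq 0$, $a(b+c)=ab+ac$ and $(b+c)a=ba+ca$ for all $a,b,c\in S$, and $a\cdot 0=0\cdot a=0$ for all $a\in S$. $S$ is zerosumfree if $s+t=0$ implies $s=t=0$ for all $s,t\in S$. A semiring is reversible if $st=0$ implies $ts=0$ for all its elements $s,t$. $S[[X]]$ is the semiring of formal power series in an indeterminate $X$ commuting with the coefficients. *)

theory Defs
  imports "HOL-Computational_Algebra.Formal_Power_Series"
begin

text \<open>
  A semiring is a type of class \<^class>\<open>semiring_1\<close>: multiplication need not commute,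
  addition need not cancel, and \<open>0 \<noteq> 1\<close>. The power series semiring over \<open>'a\<close> is \<open>'a fps\<close>.
\<close>

definition zerosumfree :: "'a::semiring_1 itself \<Rightarrow> bool" where
  "zerosumfree _ \<longleftrightarrow> (\<forall>s t :: 'a. s + t = 0 \<longrightarrow> s = 0 \<and> t = 0)"

definition reversible :: "'a::semiring_1 itself \<Rightarrow> bool" where
  "reversible _ \<longleftrightarrow> (\<forall>s t :: 'a. s * t = 0 \<longrightarrow> t * s = 0)"

end

theory Submission
  imports Defs
begin

text \<open>
  Over a zerosumfree semiring no cancellation can occur in the coefficients of a product of power
  series, so \<open>f * g = 0\<close> holds exactly when every coefficient of \<open>f\<close> annihilates every
  coefficient of \<open>g\<close> from the left. Reversibility therefore transfers coefficientwise.
\<close>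

text \<open>Induction on the finite set: zerosumfreeness splits off one summand at a time.\<close>

lemma zerosumfree_sum_eq_0_iff:
  fixes h :: "'b \<Rightarrow> 'a::semiring_1"
  assumes "zerosumfree TYPE('a)" and "finite A"
  shows "sum h A = 0 \<longleftrightarrow> (\<forall>x\<in>A. h x = 0)"
  using assms(2)
proof induction
  case (insert x A)
  have "h x + sum h A = 0 \<longleftrightarrow> h x = 0 \<and> sum h A = 0"
    using assms(1) unfolding zerosumfree_def by (metis add_0)
  with insert show ?case
    by simp
qed simp

lemma zerosumfree_fps_mult_eq_0_iff:
  fixes f g :: "'a::semiring_1 fps"
  assumes "zerosumfree TYPE('a)"
  shows "f * g = 0 \<longleftrightarrow> (\<forall>i j. fps_nth f i * fps_nth g j = 0)"
proof
  assume "f * g = 0"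
  show "\<forall>i j. fps_nth f i * fps_nth g j = 0"
  proof (intro allI)
    fix i j
    \<comment> \<open>Degree \<open>i + j\<close> is chosen because the summand at
      \<open>k = i\<close> is exactly the wanted product.\<close>
    have "(\<Sum>k=0..i + j. fps_nth f k * fps_nth g (i + j - k)) = 0"
      using \<open>f * g = 0\<close> by (metis fps_mult_nth fps_zero_nth)
    then have "\<forall>k\<in>{0..i + j}. fps_nth f k * fps_nth g (i + j - k) = 0"
      by (simp add: zerosumfree_sum_eq_0_iff[OF assms])
    then show "fps_nth f i * fps_nth g j = 0"
      by (metis add_diff_cancel_left' atLeastAtMost_iff le0 le_add1)
  qed
qed (simp add: fps_eq_iff fps_mult_nth)

theorem theorem4p5:
  assumes "zerosumfree TYPE('a::semiring_1)"
  shows "reversible TYPE('a) \<longleftrightarrow> reversible TYPE('a fps)"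
proof
  assume "reversible TYPE('a)"
  then show "reversible TYPE('a fps)"
    \<comment> \<open>Reversibility of the coefficients flips each product, giving the criterion for
      the swapped series with \<open>i\<close> and \<open>j\<close> exchanged.\<close>
    unfolding reversible_def zerosumfree_fps_mult_eq_0_iff[OF assms] by blast
next
  assume rev: "reversible TYPE('a fps)"
  show "reversible TYPE('a)"
    unfolding reversible_def
  proof (intro allI impI)
    fix s t :: 'a
    assume "s * t = 0"
    \<comment> \<open>\<open>fps_const\<close> is multiplicative and injective, so reversibility can
      be pulled back along it.\<close>
    then have "fps_const s * fps_const t = 0"
      by simp
    then have "fps_const t * fps_const s = 0"
      using rev unfolding reversible_def by blast
    then show "t * s = 0"
      by simp
  qed
qed

end
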